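(* For any complete, separated topological associative ring $\mathfrak R$ with a base of neighborhoods of zero formed by open right ideals, the topological Jacobson radical $\mathfrak H\subset\mathfrak R$ is a closed two-sided ideal in $\mathfrak R$.
   Context: Rings are associative with unit. A topological ring $\mathfrak R$ is separated (resp. complete) if the natural map $\mathfrak R\to\varprojlim_{\mathfrak U}\mathfrak R/\mathfrak U$, over all open additive subgroups $\mathfrak U$, is injective (resp. surjective). The topological Jacobson radical of $\mathfrak R$ is the intersection of all open maximal right ideals of $\mathfrak R$, i.e., of all maximal right ideals that are also open. *)

theory Defs
  imports "HOL-Analysis.Product_Topology" "HOL-Algebra.Ideal"
begin

text \<open>The locale \<^locale>\<open>ring\<close> of associative unital rings does not exclude the zero ring. The
  topology is not assumed to be Hausdorff.\<close>

locale topological_ring = ring R for R (structure) +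
  fixes T :: "'a topology"
  assumes topspace_eq: "topspace T = carrier R"
    and continuous_add: "continuous_map (prod_topology T T) T (\<lambda>(x, y). x \<oplus> y)"
    and continuous_minus: "continuous_map T T (\<lambda>x. \<ominus> x)"
    and continuous_mult: "continuous_map (prod_topology T T) T (\<lambda>(x, y). x \<otimes> y)"

locale right_ideal = additive_subgroup I R + ring R for I and R (structure) +
  assumes I_r_closed: "\<lbrakk>a \<in> I; x \<in> carrier R\<rbrakk> \<Longrightarrow> a \<otimes> x \<in> I"

locale maximal_right_ideal = right_ideal I R for I and R (structure) +
  assumes I_notcarr: "carrier R \<noteq> I"
    and I_maximal: "\<lbrakk>right_ideal J R; I \<subseteq> J; J \<subseteq> carrier R\<rbrakk> \<Longrightarrow> J = I \<or> J = carrier R"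

definition open_subgroups :: "('a, 'b) ring_scheme \<Rightarrow> 'a topology \<Rightarrow> 'a set set"
  where "open_subgroups R T = {U. additive_subgroup U R \<and> openin T U}"

text \<open>The elements of the projective limit of the groups \<open>R/U\<close> are the families of cosets that are
  compatible with the transition maps \<open>R/U \<rightarrow> R/V\<close>, \<open>U + x \<mapsto> V + x\<close>, for \<open>U \<subseteq> V\<close>.\<close>

definition completion :: "('a, 'b) ring_scheme \<Rightarrow> 'a topology \<Rightarrow> ('a set \<Rightarrow> 'a set) set"
  where "completion R T =
    {c \<in> (\<Pi>\<^sub>E U\<in>open_subgroups R T. a_rcosets\<^bsub>R\<^esub> U).
       \<forall>U\<in>open_subgroups R T. \<forall>V\<in>open_subgroups R T. U \<subseteq> V \<longrightarrow>
         (\<forall>x\<in>carrier R. c U = U +>\<^bsub>R\<^esub> x \<longrightarrow> c V = V +>\<^bsub>R\<^esub> x)}"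

definition to_completion :: "('a, 'b) ring_scheme \<Rightarrow> 'a topology \<Rightarrow> 'a \<Rightarrow> 'a set \<Rightarrow> 'a set"
  where "to_completion R T x = (\<lambda>U\<in>open_subgroups R T. U +>\<^bsub>R\<^esub> x)"

lemma to_completion_in_completion:
  assumes "ring R" "x \<in> carrier R"
  shows "to_completion R T x \<in> completion R T"
proof -
  interpret ring R by fact
  have "V +>\<^bsub>R\<^esub> x = V +>\<^bsub>R\<^esub> y"
    if U: "U \<in> open_subgroups R T" and V: "V \<in> open_subgroups R T" and sub: "U \<subseteq> V"
      and y: "y \<in> carrier R" and eq: "U +>\<^bsub>R\<^esub> x = U +>\<^bsub>R\<^esub> y" for U V y
  proof -
    interpret U: additive_subgroup U R using U by (simp add: open_subgroups_def)
    interpret V: additive_subgroup V R using V by (simp add: open_subgroups_def)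
    have "y \<in> U +>\<^bsub>R\<^esub> y"
      using y U.zero_closed by (force simp: a_r_coset_def')
    then have "y \<in> V +>\<^bsub>R\<^esub> x"
      using eq sub by (auto simp: a_r_coset_def')
    then show ?thesis
      using add.repr_independence[OF _ assms(2) V.a_subgroup] unfolding a_r_coset_def by blast
  qed
  note compatible = this
  have "to_completion R T x \<in> (\<Pi>\<^sub>E U\<in>open_subgroups R T. a_rcosets\<^bsub>R\<^esub> U)"
    using assms(2) by (auto simp: to_completion_def A_RCOSETS_def')
  moreover have "to_completion R T x V = V +>\<^bsub>R\<^esub> y"
    if "U \<in> open_subgroups R T" "V \<in> open_subgroups R T" "U \<subseteq> V"
      "y \<in> carrier R" "to_completion R T x U = U +>\<^bsub>R\<^esub> y" for U V y
    using compatible[of U V y] that unfolding to_completion_def by (simp only: restrict_apply')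
  ultimately show ?thesis
    unfolding completion_def by blast
qed

definition separated_ring :: "('a, 'b) ring_scheme \<Rightarrow> 'a topology \<Rightarrow> bool"
  where "separated_ring R T \<longleftrightarrow> inj_on (to_completion R T) (carrier R)"

definition complete_ring :: "('a, 'b) ring_scheme \<Rightarrow> 'a topology \<Rightarrow> bool"
  where "complete_ring R T \<longleftrightarrow> to_completion R T ` carrier R = completion R T"

definition right_ideal_base :: "('a, 'b) ring_scheme \<Rightarrow> 'a topology \<Rightarrow> bool"
  where "right_ideal_base R T \<longleftrightarrow>
    (\<forall>W. openin T W \<and> \<zero>\<^bsub>R\<^esub> \<in> W \<longrightarrow> (\<exists>I. right_ideal I R \<and> openin T I \<and> I \<subseteq> W))"

text \<open>The intersection is taken inside the carrier, so it is the whole ring if there are no open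
  maximal right ideals.\<close>

definition topological_jacobson_radical :: "('a, 'b) ring_scheme \<Rightarrow> 'a topology \<Rightarrow> 'a set"
  where "topological_jacobson_radical R T =
    carrier R \<inter> \<Inter>{M. maximal_right_ideal M R \<and> openin T M}"

end

theory Submission
  imports Defs
begin

text \<open>If \<open>M\<close> is an open maximal right ideal and \<open>x \<notin> M\<close>, then \<open>{r. x r \<in> M}\<close> is the kernel of the
  map \<open>r \<mapsto> x r + M\<close> onto the simple discrete right module \<open>R/M\<close>, so it is again an open maximal
  right ideal and contains the radical. Hence the radical is stable under left multiplication.
  It is closed since open subgroups are closed.\<close>

context right_ideal
begin

text \<open>Left multiplication by \<open>x\<close> is an endomorphism of R as a right module, and
  the preimage of a submodule is a submodule.\<close>

lemma right_ideal_left_vimage: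
  assumes "x \<in> carrier R"
  shows "right_ideal {r \<in> carrier R. x \<otimes> r \<in> I} R"
proof -
  have "subgroup {r \<in> carrier R. x \<otimes> r \<in> I} (add_monoid R)"
  proof (rule add.subgroupI)
    fix a assume "a \<in> {r \<in> carrier R. x \<otimes> r \<in> I}"
    then show "\<ominus> a \<in> {r \<in> carrier R. x \<otimes> r \<in> I}"
      using assms a_inv_closed[of "x \<otimes> a"] by (simp add: r_minus)
  qed (use assms in \<open>auto simp: r_distr intro!: exI[of _ "\<zero>"]\<close>)
  then show ?thesis
    using assms
    by (intro right_ideal.intro additive_subgroup.intro right_ideal_axioms.intro ring_axioms)
      (auto simp: m_assoc[symmetric] I_r_closed)
qed

text \<open>This is the sum of the submodules \<open>I\<close> and xJ of the right module R. It
  carries \<open>J\<close> to a right ideal above \<open>I\<close>, where maximality of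
  \<open>I\<close> can be applied.\<close>

lemma right_ideal_add_left_image:
  assumes "right_ideal J R" and x: "x \<in> carrier R"
  shows "right_ideal {m \<oplus> x \<otimes> j | m j. m \<in> I \<and> j \<in> J} R" (is "right_ideal ?K R")
proof -
  interpret J: right_ideal J R by fact
  have "subgroup ?K (add_monoid R)"
  proof (rule add.subgroupI)
    show "?K \<subseteq> carrier R"
      using x by (auto simp: a_Hcarr J.a_Hcarr)
    show "?K \<noteq> {}"
      using additive_subgroup.zero_closed[OF is_additive_subgroup] J.zero_closed by blast
  next
    fix a assume "a \<in> ?K"
    then obtain m j where a: "a = m \<oplus> x \<otimes> j" and mj: "m \<in> I" "j \<in> J" by auto
    have "\<ominus> a = \<ominus> m \<oplus> x \<otimes> (\<ominus> j)"
      using mj x by (simp add: a a_Hcarr J.a_Hcarr minus_add r_minus)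
    then show "\<ominus> a \<in> ?K"
      using additive_subgroup.a_inv_closed[OF is_additive_subgroup mj(1)]
        J.a_inv_closed[OF mj(2)] by blast
  next
    fix a b assume "a \<in> ?K" "b \<in> ?K"
    then obtain m j n k where a: "a = m \<oplus> x \<otimes> j" and mj: "m \<in> I" "j \<in> J"
      and b: "b = n \<oplus> x \<otimes> k" and nk: "n \<in> I" "k \<in> J" by auto
    have "a \<oplus> b = (m \<oplus> n) \<oplus> x \<otimes> (j \<oplus> k)"
      using mj nk x by (simp add: a b a_Hcarr J.a_Hcarr r_distr a_ac)
    then show "a \<oplus> b \<in> ?K"
      using additive_subgroup.a_closed[OF is_additive_subgroup mj(1) nk(1)]
        J.a_closed[OF mj(2) nk(2)] by blast
  qed
  moreover have "a \<otimes> r \<in> ?K" if "a \<in> ?K" and r: "r \<in> carrier R" for a r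
  proof -
    obtain m j where a: "a = m \<oplus> x \<otimes> j" and mj: "m \<in> I" "j \<in> J" using \<open>a \<in> ?K\<close> by auto
    have "a \<otimes> r = m \<otimes> r \<oplus> x \<otimes> (j \<otimes> r)"
      using mj x r by (simp add: a a_Hcarr J.a_Hcarr l_distr m_assoc)
    then show ?thesis
      using I_r_closed J.I_r_closed mj r by blast
  qed
  ultimately show ?thesis
    by (intro right_ideal.intro additive_subgroup.intro right_ideal_axioms.intro ring_axioms)
qed

end

text \<open>Simplicity of R/I is used without building the quotient module: a right ideal
  \<open>J\<close> above \<open>?N\<close> is pushed forward to I + xJ, which lies between
  \<open>I\<close> and R.\<close>

lemma (in maximal_right_ideal) maximal_right_ideal_left_vimage:
  assumes x: "x \<in> carrier R" "x \<notin> I"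
  shows "maximal_right_ideal {r \<in> carrier R. x \<otimes> r \<in> I} R" (is "maximal_right_ideal ?N R")
proof (intro maximal_right_ideal.intro maximal_right_ideal_axioms.intro)
  show "right_ideal ?N R"
    using x(1) by (rule right_ideal_left_vimage)
  show "carrier R \<noteq> ?N"
  proof
    \<comment> \<open>The map r \<mapsto> x r + I is nonzero, since it sends 1 to the class of
      \<open>x\<close>, and \<open>x\<close> is not in \<open>I\<close>.\<close>
    assume "carrier R = ?N"
    then have "\<one> \<in> ?N" by (metis one_closed)
    then show False using x by simp
  qed
  fix J assume J: "right_ideal J R" and "?N \<subseteq> J" and "J \<subseteq> carrier R"
  interpret J: right_ideal J R by fact
  \<comment> \<open>K/I is the image of \<open>J\<close> under r \<mapsto> x r + I, so by maximality
    of \<open>I\<close> it is either zero or all of R/I.\<close>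
  define K where "K = {m \<oplus> x \<otimes> j | m j. m \<in> I \<and> j \<in> J}"
  have K: "right_ideal K R"
    unfolding K_def using J x(1) by (rule right_ideal_add_left_image)
  have "I \<subseteq> K"
  proof
    fix m assume "m \<in> I"
    moreover from this have "m = m \<oplus> x \<otimes> \<zero>" using x by (simp add: a_Hcarr)
    ultimately show "m \<in> K" unfolding K_def using J.zero_closed by blast
  qed
  moreover have "K \<subseteq> carrier R"
    using x by (auto simp: K_def a_Hcarr J.a_Hcarr)
  ultimately consider "K = I" | "K = carrier R"
    using I_maximal K by blast
  then show "J = ?N \<or> J = carrier R"
  proof cases
    \<comment> \<open>The image of \<open>J\<close> is zero: xJ lies in \<open>I\<close>, hence
      \<open>J\<close> lies in \<open>?N\<close>.\<close>
    case 1
    have "x \<otimes> j \<in> I" if "j \<in> J" for j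
    proof -
      have "x \<otimes> j = \<zero> \<oplus> x \<otimes> j" using that x by (simp add: J.a_Hcarr)
      then have "x \<otimes> j \<in> K" unfolding K_def using that additive_subgroup.zero_closed[OF is_additive_subgroup] by blast
      with 1 show ?thesis by simp
    qed
    then show ?thesis
      using \<open>?N \<subseteq> J\<close> J.a_Hcarr by blast
  next
    \<comment> \<open>The image of \<open>J\<close> is everything: each \<open>r\<close> has the
      same image as some \<open>j\<close> in \<open>J\<close>, so r - j lies in the kernel
      \<open>?N\<close>, which \<open>J\<close> contains.\<close>
    case 2
    have "r \<in> J" if r: "r \<in> carrier R" for r
    proof -
      have "x \<otimes> r \<in> K" using 2 r x by simp
      then obtain m j where eq: "x \<otimes> r = m \<oplus> x \<otimes> j" and m: "m \<in> I" and j: "j \<in> J"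
        unfolding K_def by auto
      have "x \<otimes> (r \<ominus> j) = m"
        using x r m j eq
        by (simp add: minus_eq r_distr r_minus a_Hcarr J.a_Hcarr a_assoc r_neg)
      then have "r \<ominus> j \<in> J"
        using \<open>?N \<subseteq> J\<close> m r j J.a_Hcarr by auto
      then have "(r \<ominus> j) \<oplus> j \<in> J" using j by simp
      then show ?thesis using r j by (simp add: minus_eq J.a_Hcarr a_assoc l_neg)
    qed
    then show ?thesis using \<open>J \<subseteq> carrier R\<close> by blast
  qed
qed

context topological_ring
begin

lemma continuous_map_add_right:
  assumes "y \<in> carrier R"
  shows "continuous_map T T (\<lambda>z. z \<oplus> y)"
proof -
  have "continuous_map T (prod_topology T T) (\<lambda>z. (z, y))"
    using assms by (intro continuous_map_pairedI) (auto simp: topspace_eq)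
  from continuous_map_compose[OF this continuous_add] show ?thesis by (simp add: o_def)
qed

lemma continuous_map_mult_left:
  assumes "x \<in> carrier R"
  shows "continuous_map T T (\<lambda>z. x \<otimes> z)"
proof -
  have "continuous_map T (prod_topology T T) (\<lambda>z. (x, z))"
    using assms by (intro continuous_map_pairedI) (auto simp: topspace_eq)
  from continuous_map_compose[OF this continuous_mult] show ?thesis by (simp add: o_def)
qed

text \<open>The complement of U is a union of cosets of U, and each coset is open because
  translations are continuous.\<close>

lemma open_additive_subgroup_closed:
  assumes "additive_subgroup U R" and "openin T U"
  shows "closedin T U"
proof -
  interpret U: additive_subgroup U R by fact
  have "\<exists>V. openin T V \<and> y \<in> V \<and> V \<subseteq> carrier R - U" if y: "y \<in> carrier R - U" for y
  proof (intro exI conjI)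
    \<comment> \<open>This is the coset of U through \<open>y\<close>, written as the preimage of U
      under translation by -y.\<close>
    let ?V = "{z \<in> topspace T. z \<oplus> \<ominus> y \<in> U}"
    show "openin T ?V"
      using y by (intro openin_continuous_map_preimage[OF _ assms(2)] continuous_map_add_right) auto
    show "y \<in> ?V"
      using y by (simp add: topspace_eq r_neg U.zero_closed)
    show "?V \<subseteq> carrier R - U"
    proof
      fix z assume z: "z \<in> ?V"
      have "z \<notin> U"
      proof
        assume "z \<in> U"
        then have "\<ominus> (z \<oplus> \<ominus> y) \<oplus> z \<in> U"
          using z U.a_closed[OF U.a_inv_closed] by blast
        moreover have "\<ominus> (z \<oplus> \<ominus> y) \<oplus> z = y"
        proof -
          have "\<ominus> (z \<oplus> \<ominus> y) = y \<oplus> \<ominus> z"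
            using z y by (simp add: topspace_eq minus_add a_comm)
          then show ?thesis using z y by (simp add: topspace_eq a_assoc l_neg)
        qed
        ultimately show False using y by simp
      qed
      then show "z \<in> carrier R - U" using z by (simp add: topspace_eq)
    qed
  qed
  then have "openin T (carrier R - U)"
    by (subst openin_subopen) blast
  then show ?thesis
    using U.a_subset by (simp add: closedin_def topspace_eq)
qed

lemma closedin_topological_jacobson_radical:
  "closedin T (topological_jacobson_radical R T)"
proof -
  \<comment> \<open>Inserting the whole space accounts for the carrier in the definition of the
    radical and keeps the family nonempty, as \<open>closedin_Inter\<close> requires.\<close>
  have "closedin T (\<Inter>(insert (topspace T) {M. maximal_right_ideal M R \<and> openin T M}))"
  proof (rule closedin_Inter)
    fix M assume "M \<in> insert (topspace T) {M. maximal_right_ideal M R \<and> openin T M}"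
    then show "closedin T M"
      unfolding maximal_right_ideal_def right_ideal_def
      using open_additive_subgroup_closed closedin_topspace by blast
  qed simp
  then show ?thesis
    by (simp add: topological_jacobson_radical_def topspace_eq)
qed

text \<open>Membership is tested in each open maximal right ideal M. If x \<in> M, then M absorbs
  \<open>h\<close> from the right; otherwise \<open>h\<close> lies in the open maximal right ideal
  of all r with x r \<in> M.\<close>

lemma topological_jacobson_radical_mult_left:
  assumes h: "h \<in> topological_jacobson_radical R T" and x: "x \<in> carrier R"
  shows "x \<otimes> h \<in> topological_jacobson_radical R T"
proof -
  have hc: "h \<in> carrier R" using h by (simp add: topological_jacobson_radical_def)
  have "x \<otimes> h \<in> M" if M: "maximal_right_ideal M R" and "openin T M" for M
  proof (cases "x \<in> M")
    case True
    then show ?thesis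
      using M hc by (simp add: maximal_right_ideal_def right_ideal.I_r_closed)
  next
    case False
    \<comment> \<open>Continuity of multiplication enters here: left multiplication by
      \<open>x\<close> is continuous, so the preimage of M is open.\<close>
    have "openin T {r \<in> carrier R. x \<otimes> r \<in> M}"
      using openin_continuous_map_preimage[OF continuous_map_mult_left[OF x] \<open>openin T M\<close>]
      by (simp add: topspace_eq)
    moreover have "maximal_right_ideal {r \<in> carrier R. x \<otimes> r \<in> M} R"
      using M x False by (rule maximal_right_ideal.maximal_right_ideal_left_vimage)
    ultimately show ?thesis
      using h by (auto simp: topological_jacobson_radical_def)
  qed
  then show ?thesis
    using x hc by (simp add: topological_jacobson_radical_def)
qed

lemma right_ideal_topological_jacobson_radical:
  "right_ideal (topological_jacobson_radical R T) R"
proof -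
  \<comment> \<open>The family may be empty; the intersection with the carrier then gives the whole
    ring, still a right ideal.\<close>
  have "right_ideal (carrier R \<inter> \<Inter>\<M>) R" if \<M>: "\<And>M. M \<in> \<M> \<Longrightarrow> right_ideal M R" for \<M>
  proof -
    note sub = \<M>[THEN right_ideal.axioms(1)]
    have "subgroup (carrier R \<inter> \<Inter>\<M>) (add_monoid R)"
    proof (rule add.subgroupI)
      show "carrier R \<inter> \<Inter>\<M> \<noteq> {}"
        using additive_subgroup.zero_closed[OF sub] by auto
    next
      fix a assume "a \<in> carrier R \<inter> \<Inter>\<M>"
      then show "\<ominus> a \<in> carrier R \<inter> \<Inter>\<M>"
        using additive_subgroup.a_inv_closed[OF sub] by auto
    qed (use additive_subgroup.a_closed[OF sub] in auto)
    then show ?thesis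
      by (intro right_ideal.intro additive_subgroup.intro right_ideal_axioms.intro ring_axioms)
        (auto intro: right_ideal.I_r_closed[OF \<M>])
  qed
  from this[of "{M. maximal_right_ideal M R \<and> openin T M}"] show ?thesis
    by (simp add: topological_jacobson_radical_def maximal_right_ideal.axioms(1))
qed

lemma ideal_topological_jacobson_radical:
  "ideal (topological_jacobson_radical R T) R"
proof -
  interpret H: right_ideal "topological_jacobson_radical R T" R
    by (rule right_ideal_topological_jacobson_radical)
  show ?thesis
    by (rule idealI[OF ring_axioms H.a_subgroup topological_jacobson_radical_mult_left
          H.I_r_closed])
qed

end

theorem lemma7p1:
  fixes R :: "('a, 'b) ring_scheme" and T :: "'a topology"
  assumes "topological_ring R T"
    and "complete_ring R T"
    and "separated_ring R T"
    and "right_ideal_base R T"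
  shows "closedin T (topological_jacobson_radical R T) \<and>
         ideal (topological_jacobson_radical R T) R"
  using assms(1) topological_ring.closedin_topological_jacobson_radical
    topological_ring.ideal_topological_jacobson_radical by blast

end
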